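(* Let $F:\mathbb{R}^3\to\mathbb{R}^3$ be a smooth vector field independent of $v_s$, and for each speed $v_s>0$ consider the flat-slice unit-lapse drive with shift $\beta^i=v_s\,F^i(\mathbf{x})$, i.e. the metric $ds^2=-dt^2+\delta_{ij}(dx^i+\beta^i dt)(dx^j+\beta^j dt)$. Let $\rho_n=T_{ab}n^an^b$ be its Eulerian energy density and let $$E_-(v_s)=\int_{\{\rho_n<0\}}|\rho_n|\,dV$$ be the Eulerian integrated negative energy, the integral being taken over a fixed integration domain (independent of $v_s$) in the slice. Then $$E_-(v_s)=v_s^2\,E_-(1)$$ identically in $v_s$.
   Context: Signature $(-+++)$, units $G=c=1$. $T_{ab}=G_{ab}/8\pi$ with $G_{ab}$ the Einstein tensor of the metric; $n^a=\partial_t-\beta^i\partial_i$ is the unit normal to the slices $t=\text{const}$; $dV$ is the proper volume element of the (flat) slice, i.e. $d^3x$. $E_-$ takes values in $[0,\infty]$. *)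

theory Defs
  imports "HOL-Analysis.Analysis"
begin

section \<open>Smooth maps\<close>

fun continuously_differentiable ::
  "nat \<Rightarrow> ('a::real_normed_vector \<Rightarrow> 'b::real_normed_vector) \<Rightarrow> bool" where
  "continuously_differentiable 0 f \<longleftrightarrow> continuous_on UNIV f"
| "continuously_differentiable (Suc k) f \<longleftrightarrow>
     (\<forall>x. f differentiable (at x)) \<and>
     (\<forall>v. continuously_differentiable k (\<lambda>x. frechet_derivative f (at x) v))"

definition smooth :: "('a::real_normed_vector \<Rightarrow> 'b::real_normed_vector) \<Rightarrow> bool" where
  "smooth f \<longleftrightarrow> (\<forall>k. continuously_differentiable k f)"

section \<open>Curvature of a metric in a global coordinate chart\<close>

text \<open>
  The sign conventions are those of Misner, Thorne and Wheeler. All components refer to the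
  coordinate basis; a point is the vector of its coordinates.
\<close>

type_synonym 'n metric = "real ^ 'n \<Rightarrow> real ^ 'n ^ 'n"

definition partial :: "'n::finite \<Rightarrow> (real ^ 'n \<Rightarrow> real) \<Rightarrow> real ^ 'n \<Rightarrow> real" where
  "partial a f p = deriv (\<lambda>h. f (p + h *\<^sub>R axis a 1)) 0"

text \<open>\<open>christoffel g c a b p\<close> is \<open>\<Gamma>\<^sup>c\<^sub>a\<^sub>b\<close> at \<open>p\<close>.\<close>

definition christoffel :: "'n::finite metric \<Rightarrow> 'n \<Rightarrow> 'n \<Rightarrow> 'n \<Rightarrow> real ^ 'n \<Rightarrow> real" where
  "christoffel g c a b p =
     (\<Sum>d\<in>UNIV. matrix_inv (g p) $ c $ d *
        (partial a (\<lambda>q. g q $ d $ b) p + partial b (\<lambda>q. g q $ d $ a) p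
          - partial d (\<lambda>q. g q $ a $ b) p)) / 2"

text \<open>\<open>riemann g a b c d p\<close> is \<open>R\<^sup>a\<^sub>b\<^sub>c\<^sub>d\<close> at \<open>p\<close>.\<close>

definition riemann :: "'n::finite metric \<Rightarrow> 'n \<Rightarrow> 'n \<Rightarrow> 'n \<Rightarrow> 'n \<Rightarrow> real ^ 'n \<Rightarrow> real" where
  "riemann g a b c d p =
     partial c (christoffel g a d b) p - partial d (christoffel g a c b) p
     + (\<Sum>e\<in>UNIV. christoffel g a c e p * christoffel g e d b p
                 - christoffel g a d e p * christoffel g e c b p)"

definition ricci :: "'n::finite metric \<Rightarrow> 'n \<Rightarrow> 'n \<Rightarrow> real ^ 'n \<Rightarrow> real" where
  "ricci g a b p = (\<Sum>c\<in>UNIV. riemann g c a c b p)"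

definition scalar_curvature :: "'n::finite metric \<Rightarrow> real ^ 'n \<Rightarrow> real" where
  "scalar_curvature g p = (\<Sum>a\<in>UNIV. \<Sum>b\<in>UNIV. matrix_inv (g p) $ a $ b * ricci g a b p)"

definition einstein :: "'n::finite metric \<Rightarrow> 'n \<Rightarrow> 'n \<Rightarrow> real ^ 'n \<Rightarrow> real" where
  "einstein g a b p = ricci g a b p - scalar_curvature g p * g p $ a $ b / 2"

text \<open>The field equations, in units with \<open>G = c = 1\<close>, read as the definition of \<open>T\<^sub>a\<^sub>b\<close>.\<close>

definition stress_energy :: "'n::finite metric \<Rightarrow> 'n \<Rightarrow> 'n \<Rightarrow> real ^ 'n \<Rightarrow> real" where
  "stress_energy g a b p = einstein g a b p / (8 * pi)"

section \<open>Flat-slice unit-lapse drives\<close>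

text \<open>
  Spacetime indices are of type \<open>1 + 3\<close>: \<open>Inl 1\<close> is the time index and \<open>Inr i\<close> are the
  spatial ones.
\<close>

type_synonym event = "real ^ (1 + 3)"

definition event :: "real \<Rightarrow> real ^ 3 \<Rightarrow> event" where
  "event t x = (\<chi> a. case a of Inl _ \<Rightarrow> t | Inr i \<Rightarrow> x $ i)"

definition spatial :: "event \<Rightarrow> real ^ 3" where
  "spatial p = (\<chi> i. p $ Inr i)"

text \<open>Components of the coordinate one-forms \<open>dt\<close> and \<open>dx\<^sup>i\<close>.\<close>

definition dt :: "1 + 3 \<Rightarrow> real" where
  "dt a = (if a = Inl 1 then 1 else 0)"

definition dx :: "3 \<Rightarrow> 1 + 3 \<Rightarrow> real" where
  "dx i a = (if a = Inr i then 1 else 0)"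

text \<open>
  \<open>ds\<^sup>2 = - dt\<^sup>2 + \<delta>\<^sub>i\<^sub>j (dx\<^sup>i + \<beta>\<^sup>i dt) (dx\<^sup>j + \<beta>\<^sup>j dt)\<close> for a time-independent shift \<open>\<beta>\<close>
\<close>

definition drive_metric :: "(real ^ 3 \<Rightarrow> real ^ 3) \<Rightarrow> (1 + 3) metric" where
  "drive_metric \<beta> p = (\<chi> a b. - dt a * dt b
     + (\<Sum>i\<in>UNIV. (dx i a + \<beta> (spatial p) $ i * dt a) * (dx i b + \<beta> (spatial p) $ i * dt b)))"

text \<open>The unit normal \<open>\<partial>\<^sub>t - \<beta>\<^sup>i \<partial>\<^sub>i\<close> to the slices of constant \<open>t\<close>.\<close>

definition unit_normal :: "(real ^ 3 \<Rightarrow> real ^ 3) \<Rightarrow> event \<Rightarrow> real ^ (1 + 3)" where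
  "unit_normal \<beta> p = event 1 (- \<beta> (spatial p))"

definition eulerian_density :: "(real ^ 3 \<Rightarrow> real ^ 3) \<Rightarrow> event \<Rightarrow> real" where
  "eulerian_density \<beta> p =
     (\<Sum>a\<in>UNIV. \<Sum>b\<in>UNIV.
        stress_energy (drive_metric \<beta>) a b p * unit_normal \<beta> p $ a * unit_normal \<beta> p $ b)"

text \<open>
  Integrated negative energy over the domain \<open>D\<close> in the slice at time \<open>t\<close> for the shift
  \<open>\<beta> = v F\<close>. The induced metric \<open>\<delta>\<^sub>i\<^sub>j\<close> on the slice is flat, so its proper volume element is
  Lebesgue measure in the coordinates.
\<close>

definition negative_energy ::
  "(real ^ 3 \<Rightarrow> real ^ 3) \<Rightarrow> (real ^ 3) set \<Rightarrow> real \<Rightarrow> real \<Rightarrow> ennreal" where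
  "negative_energy F D t v =
     (let \<rho> = (\<lambda>x. eulerian_density (\<lambda>y. v *\<^sub>R F y) (event t x))
      in \<integral>\<^sup>+x\<in>{x \<in> D. \<rho> x < 0}. ennreal \<bar>\<rho> x\<bar> \<partial>lebesgue)"

end

theory Submission
  imports Defs
begin

text \<open>
  Since \<open>G(n,n) = (R(n,n) + \<Sum>\<^sub>i R\<^sub>i\<^sub>i) / 2\<close> for a unit timelike normal over flat slices, it suffices to
  compute these two contractions of the Ricci tensor. The metric has determinant \<open>- 1\<close>, so
  \<open>\<Gamma>\<^sup>c\<^sub>c\<^sub>b = 0\<close> and \<open>R\<^sub>a\<^sub>b = \<partial>\<^sub>k \<Gamma>\<^sup>k\<^sub>a\<^sub>b - \<Gamma>\<^sup>c\<^sub>b\<^sub>e \<Gamma>\<^sup>e\<^sub>c\<^sub>a\<close>. All terms of degree above two in the shift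
  cancel in the contractions, so the Eulerian density is a quadratic form in the shift and its
  derivatives. Hence it scales with \<open>v\<^sup>2\<close>, the set where it is negative does not depend on \<open>v\<close>, and
  the integral scales accordingly.
\<close>

section \<open>Finite sums over spacetime indices\<close>

lemma sum_spacetime:
  "(\<Sum>a\<in>UNIV. f a) = f (Inl 1) + (\<Sum>i\<in>UNIV. f (Inr i))" for f :: "1 + 3 \<Rightarrow> 'a::comm_monoid_add"
proof -
  have "(UNIV :: (1 + 3) set) = insert (Inl 1) (range Inr)"
    by (auto simp: UNIV_sum)
  then have "(\<Sum>a\<in>UNIV. f a) = (\<Sum>a\<in>insert (Inl 1) (range Inr). f a)"
    by (rule sum.cong) simp
  then show ?thesis
    by (simp add: sum.reindex image_iff)
qed

lemma sum_swap_pairs: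
  "(\<Sum>a\<in>A. \<Sum>b\<in>B. \<Sum>c\<in>C. \<Sum>d\<in>D. f a b c d) = (\<Sum>c\<in>C. \<Sum>d\<in>D. \<Sum>a\<in>A. \<Sum>b\<in>B. f a b c d)"
proof -
  have "(\<Sum>a\<in>A. \<Sum>b\<in>B. \<Sum>c\<in>C. \<Sum>d\<in>D. f a b c d) = (\<Sum>a\<in>A. \<Sum>c\<in>C. \<Sum>b\<in>B. \<Sum>d\<in>D. f a b c d)"
    by (rule sum.cong[OF refl], rule sum.swap)
  also have "\<dots> = (\<Sum>c\<in>C. \<Sum>a\<in>A. \<Sum>b\<in>B. \<Sum>d\<in>D. f a b c d)"
    by (rule sum.swap)
  also have "\<dots> = (\<Sum>c\<in>C. \<Sum>a\<in>A. \<Sum>d\<in>D. \<Sum>b\<in>B. f a b c d)"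
    by (rule sum.cong[OF refl], rule sum.cong[OF refl], rule sum.swap)
  also have "\<dots> = (\<Sum>c\<in>C. \<Sum>d\<in>D. \<Sum>a\<in>A. \<Sum>b\<in>B. f a b c d)"
    by (rule sum.cong[OF refl], rule sum.swap)
  finally show ?thesis .
qed

section \<open>Calculus of coordinate partial derivatives\<close>

lemma differentiable_comp_nth [simp]:
  "f differentiable F \<Longrightarrow> (\<lambda>x. f x $ i) differentiable F"
  unfolding differentiable_def using bounded_linear.has_derivative[OF bounded_linear_vec_nth]
  by blast

text \<open>The chain rule along the coordinate line through \<open>p\<close>. It turns the
  one-variable \<open>deriv\<close> behind \<open>partial\<close> into a Frechet derivative, so that
  the sum and product rules below follow from those for \<open>has_derivative\<close>.\<close>

lemma partial_eq_frechet_derivative: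
  assumes "f differentiable at p"
  shows "partial a f p = frechet_derivative f (at p) (axis a 1)"
proof -
  \<comment> \<open>The base point is written as the value of the line at \<open>0\<close>, the form
    in which the chain rule expects it.\<close>
  have f: "(f has_derivative frechet_derivative f (at p)) (at (p + 0 *\<^sub>R axis a 1))"
    using assms by (simp flip: frechet_derivative_works)
  have "((\<lambda>h. p + h *\<^sub>R axis a 1) has_derivative (\<lambda>h. h *\<^sub>R axis a 1)) (at (0::real))"
    by (auto intro!: derivative_eq_intros)
  from has_derivative_compose[OF this f]
  have "((\<lambda>h. f (p + h *\<^sub>R axis a 1)) has_real_derivative
      frechet_derivative f (at p) (axis a 1)) (at 0)"
    using linear_frechet_derivative[OF assms]
    by (simp add: has_field_derivative_def linear_cmul mult_commute_abs)
  then show ?thesis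
    unfolding partial_def by (rule DERIV_imp_deriv)
qed

lemma partial_eqI:
  assumes "(f has_derivative f') (at p)"
  shows "partial a f p = f' (axis a 1)"
  using partial_eq_frechet_derivative[OF differentiableI[OF assms]] frechet_derivative_at[OF assms]
  by simp

lemma partial_const [simp]: "partial a (\<lambda>q. c) p = 0"
  by (simp add: partial_def)

lemma partial_add [simp]:
  assumes "f differentiable at p" "g differentiable at p"
  shows "partial a (\<lambda>q. f q + g q) p = partial a f p + partial a g p"
  using assms partial_eqI[OF has_derivative_add[OF assms[unfolded frechet_derivative_works]]]
  by (simp add: partial_eq_frechet_derivative)

lemma partial_diff [simp]:
  assumes "f differentiable at p" "g differentiable at p"
  shows "partial a (\<lambda>q. f q - g q) p = partial a f p - partial a g p"
  using assms partial_eqI[OF has_derivative_diff[OF assms[unfolded frechet_derivative_works]]]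
  by (simp add: partial_eq_frechet_derivative)

lemma partial_mult [simp]:
  assumes "f differentiable at p" "g differentiable at p"
  shows "partial a (\<lambda>q. f q * g q) p = partial a f p * g p + f p * partial a g p"
  using assms partial_eqI[OF has_derivative_mult[OF assms[unfolded frechet_derivative_works]]]
  by (simp add: partial_eq_frechet_derivative algebra_simps)

lemma partial_divide_const [simp]:
  assumes "f differentiable at p"
  shows "partial a (\<lambda>q. f q / c) p = partial a f p / c"
  using partial_mult[OF assms, of "\<lambda>q. 1 / c"] by simp

lemma partial_sum [simp]:
  assumes "\<And>i. i \<in> I \<Longrightarrow> f i differentiable at p"
  shows "partial a (\<lambda>q. \<Sum>i\<in>I. f i q) p = (\<Sum>i\<in>I. partial a (f i) p)"
  using assms
proof (induction I rule: infinite_finite_induct)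
  case (insert i I)
  then show ?case by (simp add: differentiable_sum)
qed simp_all

lemma differentiable_divide_const [simp]:
  "f differentiable at x within S \<Longrightarrow> (\<lambda>x. f x / c) differentiable at x within S" for c :: real
  unfolding divide_inverse by (rule differentiable_mult) simp_all

section \<open>The drive metric and its inverse\<close>

lemma spatial_event [simp]: "spatial (event t x) = x"
  by (simp add: spatial_def event_def vec_eq_iff)

lemma spatial_displaced [simp]:
  "spatial (p + h *\<^sub>R axis (Inl i) 1) = spatial p"
  "spatial (p + h *\<^sub>R axis (Inr k) 1) = spatial p + h *\<^sub>R axis k 1"
  by (simp_all add: spatial_def vec_eq_iff axis_def)

text \<open>Fields pulled back from the slice are stationary, and along spatial axes both sides
  differentiate the same function of the displacement.\<close>

lemma partial_spatial [simp]:
  "partial (Inl i) (\<lambda>q. f (spatial q)) p = 0"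
  "partial (Inr k) (\<lambda>q. f (spatial q)) p = partial k f (spatial p)"
  by (simp_all add: partial_def)

lemma drive_metric_nth:
  "drive_metric \<beta> p $ Inl i $ Inl j = - 1 + (\<Sum>k\<in>UNIV. \<beta> (spatial p) $ k * \<beta> (spatial p) $ k)"
  "drive_metric \<beta> p $ Inl i $ Inr k = \<beta> (spatial p) $ k"
  "drive_metric \<beta> p $ Inr k $ Inl i = \<beta> (spatial p) $ k"
  "drive_metric \<beta> p $ Inr k $ Inr l = (if k = l then 1 else 0)"
  by (simp_all add: drive_metric_def dt_def dx_def mult_delta_left mult_delta_right)

text \<open>\<open>matrix_inv\<close> is a choice among two-sided inverses. Over a field a right
  inverse of a square matrix is also a left inverse, and two-sided inverses are unique.\<close>

lemma matrix_inv_eqI: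
  fixes A :: "'a::field ^ 'n ^ 'n"
  assumes "A ** B = mat 1"
  shows "matrix_inv A = B"
  unfolding matrix_inv_def
proof (rule some_equality)
  show "A ** B = mat 1 \<and> B ** A = mat 1"
    using assms matrix_left_right_inverse by blast
next
  fix C assume "A ** C = mat 1 \<and> C ** A = mat 1"
  then show "C = B"
    using assms by (metis matrix_mul_assoc matrix_mul_lid matrix_mul_rid)
qed

text \<open>The inverse metric splits into the flat spatial part minus the square of the unit
  normal. This form later expresses the scalar curvature through the two wanted contractions of the
  Ricci tensor.\<close>

lemma matrix_inv_drive_metric:
  "matrix_inv (drive_metric \<beta> p) =
     (\<chi> a b. (\<Sum>k\<in>UNIV. dx k a * dx k b) - unit_normal \<beta> p $ a * unit_normal \<beta> p $ b)"
proof -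
  define h where "h = (\<chi> a b. (\<Sum>k\<in>UNIV. dx k a * dx k b) - unit_normal \<beta> p $ a * unit_normal \<beta> p $ b)"
  have h: "h $ Inl i $ Inl j = - 1"
    "h $ Inl i $ Inr k = \<beta> (spatial p) $ k"
    "h $ Inr k $ Inl i = \<beta> (spatial p) $ k"
    "h $ Inr k $ Inr l = (if k = l then 1 else 0) - \<beta> (spatial p) $ k * \<beta> (spatial p) $ l"
    for i j k l
    by (simp_all add: h_def unit_normal_def event_def dx_def mult_delta_left)
  have "drive_metric \<beta> p ** h = mat 1"
    unfolding vec_eq_iff
  proof (intro allI)
    fix a b :: "1 + 3"
    show "(drive_metric \<beta> p ** h) $ a $ b = mat 1 $ a $ b"
      by (cases a; cases b)
        (simp_all add: matrix_matrix_mult_def sum_spacetime h drive_metric_nth mat_def mult_delta_left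
          mult_delta_right left_diff_distrib right_diff_distrib sum_subtractf sum_distrib_right mult.assoc
          sum_negf num1_eq_iff)
  qed
  then have "matrix_inv (drive_metric \<beta> p) = h"
    by (rule matrix_inv_eqI)
  then show ?thesis
    by (simp add: h_def)
qed

lemma matrix_inv_drive_metric_nth:
  "matrix_inv (drive_metric \<beta> p) $ Inl i $ Inl j = - 1"
  "matrix_inv (drive_metric \<beta> p) $ Inl i $ Inr k = \<beta> (spatial p) $ k"
  "matrix_inv (drive_metric \<beta> p) $ Inr k $ Inl i = \<beta> (spatial p) $ k"
  "matrix_inv (drive_metric \<beta> p) $ Inr k $ Inr l =
     (if k = l then 1 else 0) - \<beta> (spatial p) $ k * \<beta> (spatial p) $ l"
  by (simp_all add: matrix_inv_drive_metric unit_normal_def event_def dx_def mult_delta_left)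

section \<open>Gradient of the shift and Christoffel symbols\<close>

text \<open>Christoffel symbols contain first derivatives of the shift, and curvature differentiates
  them once more. As a locale, the computation can be instantiated for a shift and for its
  multiples.\<close>

locale twice_differentiable_shift =
  fixes \<beta> :: "real ^ 3 \<Rightarrow> real ^ 3"
  assumes diff1 [simp]: "\<And>i x. (\<lambda>y. \<beta> y $ i) differentiable at x"
    and diff2 [simp]: "\<And>i j x. partial i (\<lambda>y. \<beta> y $ j) differentiable at x"
begin

definition grad :: "3 \<Rightarrow> 3 \<Rightarrow> real ^ 3 \<Rightarrow> real" where
  "grad i j = partial i (\<lambda>y. \<beta> y $ j)"

text \<open>The extrinsic curvature of the slices, with the sign convention
  \<open>K_ij = - nabla_i n_j\<close>.\<close>

definition strain :: "3 \<Rightarrow> 3 \<Rightarrow> real ^ 3 \<Rightarrow> real" where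
  "strain i j x = (grad i j x + grad j i x) / 2"

definition vorticity :: "3 \<Rightarrow> 3 \<Rightarrow> real ^ 3 \<Rightarrow> real" where
  "vorticity i j x = (grad i j x - grad j i x) / 2"

definition strain_shift :: "3 \<Rightarrow> real ^ 3 \<Rightarrow> real" where
  "strain_shift i x = (\<Sum>j\<in>UNIV. strain i j x * \<beta> x $ j)"

text \<open>The gradient of half the squared length of the shift; it enters through the time-time
  component of the metric.\<close>

definition grad_shift :: "3 \<Rightarrow> real ^ 3 \<Rightarrow> real" where
  "grad_shift i x = (\<Sum>j\<in>UNIV. grad i j x * \<beta> x $ j)"

definition strain_shift_shift :: "real ^ 3 \<Rightarrow> real" where
  "strain_shift_shift x = (\<Sum>i\<in>UNIV. strain_shift i x * \<beta> x $ i)"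

lemma partial_shift [simp]: "partial i (\<lambda>y. \<beta> y $ j) x = grad i j x"
  by (simp add: grad_def)

lemma differentiable_grad [simp]: "grad i j differentiable at x"
  by (simp add: grad_def)

lemma differentiable_strain [simp]: "strain i j differentiable at x"
  using strain_def[abs_def] by simp

lemma differentiable_vorticity [simp]: "vorticity i j differentiable at x"
  using vorticity_def[abs_def] by simp

lemma differentiable_strain_shift [simp]: "strain_shift i differentiable at x"
  using strain_shift_def[abs_def] by (simp add: differentiable_sum)

lemma differentiable_grad_shift [simp]: "grad_shift i differentiable at x"
  using grad_shift_def[abs_def] by (simp add: differentiable_sum)

lemma differentiable_strain_shift_shift [simp]: "strain_shift_shift differentiable at x"
  using strain_shift_shift_def[abs_def] by (simp add: differentiable_sum)

lemma strain_commute: "strain i j x = strain j i x"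
  by (simp add: strain_def)

lemma partial_drive_metric:
  "partial (Inl u) (\<lambda>q. drive_metric \<beta> q $ a $ b) p = 0"
  "partial (Inr k) (\<lambda>q. drive_metric \<beta> q $ Inl u $ Inl w) p = 2 * grad_shift k (spatial p)"
  "partial (Inr k) (\<lambda>q. drive_metric \<beta> q $ Inl u $ Inr l) p = grad k l (spatial p)"
  "partial (Inr k) (\<lambda>q. drive_metric \<beta> q $ Inr l $ Inl u) p = grad k l (spatial p)"
  "partial (Inr k) (\<lambda>q. drive_metric \<beta> q $ Inr l $ Inr m) p = 0"
proof -
  show "partial (Inl u) (\<lambda>q. drive_metric \<beta> q $ a $ b) p = 0"
    by (simp add: drive_metric_def partial_def)
  show "partial (Inr k) (\<lambda>q. drive_metric \<beta> q $ Inl u $ Inl w) p = 2 * grad_shift k (spatial p)"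
    unfolding drive_metric_nth
    by (subst partial_spatial(2)) (simp add: differentiable_sum grad_shift_def sum_distrib_left
        algebra_simps flip: mult_2)
  show "partial (Inr k) (\<lambda>q. drive_metric \<beta> q $ Inl u $ Inr l) p = grad k l (spatial p)"
    unfolding drive_metric_nth by (subst partial_spatial(2)) simp
  show "partial (Inr k) (\<lambda>q. drive_metric \<beta> q $ Inr l $ Inl u) p = grad k l (spatial p)"
    unfolding drive_metric_nth by (subst partial_spatial(2)) simp
  show "partial (Inr k) (\<lambda>q. drive_metric \<beta> q $ Inr l $ Inr m) p = 0"
    unfolding drive_metric_nth by simp
qed

text \<open>Closed form of the Christoffel symbols, which by stationarity live on the slice. The
  case distinctions stand outside the abstraction over the point, so fixing the indices leaves an
  explicit field to differentiate.\<close>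

definition \<Gamma> :: "1 + 3 \<Rightarrow> 1 + 3 \<Rightarrow> 1 + 3 \<Rightarrow> real ^ 3 \<Rightarrow> real" where
  "\<Gamma> c a b = (case c of
     Inl _ \<Rightarrow> (case a of
       Inl _ \<Rightarrow> (case b of Inl _ \<Rightarrow> (\<lambda>x. - strain_shift_shift x) | Inr j \<Rightarrow> (\<lambda>x. - strain_shift j x))
     | Inr i \<Rightarrow> (case b of Inl _ \<Rightarrow> (\<lambda>x. - strain_shift i x) | Inr j \<Rightarrow> (\<lambda>x. - strain i j x)))
   | Inr k \<Rightarrow> (case a of
       Inl _ \<Rightarrow> (case b of
         Inl _ \<Rightarrow> (\<lambda>x. \<beta> x $ k * strain_shift_shift x - grad_shift k x)
       | Inr j \<Rightarrow> (\<lambda>x. vorticity j k x + \<beta> x $ k * strain_shift j x))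
     | Inr i \<Rightarrow> (case b of
         Inl _ \<Rightarrow> (\<lambda>x. vorticity i k x + \<beta> x $ k * strain_shift i x)
       | Inr j \<Rightarrow> (\<lambda>x. \<beta> x $ k * strain i j x))))"

text \<open>The antisymmetric part of the gradient drops out of a quadratic form.\<close>

lemma strain_shift_shift_eq: "strain_shift_shift x = (\<Sum>i\<in>UNIV. \<beta> x $ i * grad_shift i x)"
  by (simp add: strain_shift_shift_def strain_shift_def strain_def grad_shift_def sum_3 field_simps)

lemma strain_shift_eq:
  "strain_shift i x = grad_shift i x - (\<Sum>j\<in>UNIV. \<beta> x $ j * vorticity i j x)"
  by (simp add: strain_shift_def strain_def grad_shift_def vorticity_def sum_3 field_simps)

lemma christoffel_drive_metric_Inl:
  "christoffel (drive_metric \<beta>) (Inl u) a b p = \<Gamma> (Inl u) a b (spatial p)"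
  by (cases a; cases b)
    (simp_all add: christoffel_def \<Gamma>_def sum_spacetime matrix_inv_drive_metric_nth
      partial_drive_metric strain_shift_shift_eq strain_shift_eq strain_def vorticity_def sum_3 field_simps)

text \<open>Row \<open>Inr k\<close> of the inverse metric is the \<open>k\<close>-th unit row minus
  the \<open>k\<close>-th shift component times the time row. So the symbol with upper index
  \<open>Inr k\<close> reduces to the lowered one and the one with upper time index.\<close>

lemma christoffel_drive_metric_Inr:
  "christoffel (drive_metric \<beta>) (Inr k) a b p =
    (partial a (\<lambda>q. drive_metric \<beta> q $ Inr k $ b) p + partial b (\<lambda>q. drive_metric \<beta> q $ Inr k $ a) p
      - partial (Inr k) (\<lambda>q. drive_metric \<beta> q $ a $ b) p) / 2
    - \<beta> (spatial p) $ k * christoffel (drive_metric \<beta>) (Inl 1) a b p"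
  unfolding christoffel_def sum_spacetime matrix_inv_drive_metric_nth
  by (simp add: left_diff_distrib sum_subtractf mult_delta_left)
     (simp add: sum_distrib_left mult.assoc field_simps)

lemma christoffel_drive_metric: "christoffel (drive_metric \<beta>) c a b p = \<Gamma> c a b (spatial p)"
proof (cases c)
  case (Inr k)
  then show ?thesis
    by (cases a; cases b)
      (simp_all add: christoffel_drive_metric_Inr christoffel_drive_metric_Inl partial_drive_metric
        \<Gamma>_def vorticity_def)
qed (simp add: christoffel_drive_metric_Inl)

lemma differentiable_\<Gamma> [simp]: "\<Gamma> c a b differentiable at x"
  by (cases c; cases a; cases b) (simp_all add: \<Gamma>_def)

lemma \<Gamma>_commute: "\<Gamma> c a b = \<Gamma> c b a"
  by (cases c; cases a; cases b) (simp_all add: \<Gamma>_def strain_commute fun_eq_iff)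

text \<open>The vorticity vanishes on the diagonal, and the remaining spatial terms cancel the term
  with upper time index.\<close>

lemma trace_\<Gamma>: "(\<Sum>c\<in>UNIV. \<Gamma> c c b x) = 0"
  by (cases b)
    (simp_all add: \<Gamma>_def sum_spacetime strain_shift_shift_def strain_shift_def vorticity_def
      sum_negf strain_commute mult.commute)

section \<open>Ricci and Einstein tensors\<close>

lemma ricci_drive_metric:
  fixes p :: event
  defines "x \<equiv> spatial p"
  shows "ricci (drive_metric \<beta>) a b p =
    (\<Sum>k\<in>UNIV. partial k (\<Gamma> (Inr k) b a) x) - (\<Sum>c\<in>UNIV. \<Sum>e\<in>UNIV. \<Gamma> c b e x * \<Gamma> e c a x)"
proof -
  have "(\<Sum>c\<in>UNIV. partial c (\<lambda>q. \<Gamma> c b a (spatial q)) p) =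
      (\<Sum>k\<in>UNIV. partial k (\<Gamma> (Inr k) b a) x)"
    by (simp add: sum_spacetime x_def)
  \<comment> \<open>A derivative of the vanishing trace, or a time derivative of a stationary
    field.\<close>
  moreover have "(\<Sum>c\<in>UNIV. partial b (\<lambda>q. \<Gamma> c c a (spatial q)) p) = 0"
  proof (cases b)
    case (Inr k)
    have "(\<Sum>c\<in>UNIV. partial k (\<Gamma> c c a) x) = partial k (\<lambda>x. \<Sum>c\<in>UNIV. \<Gamma> c c a x) x"
      by simp
    then show ?thesis
      by (simp add: Inr trace_\<Gamma> x_def)
  qed simp
  \<comment> \<open>Summing over \<open>c\<close> first exposes the trace as a factor.\<close>
  moreover have "(\<Sum>c\<in>UNIV. \<Sum>e\<in>UNIV. \<Gamma> c c e x * \<Gamma> e b a x) = 0"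
    by (subst sum.swap) (simp add: trace_\<Gamma> flip: sum_distrib_right)
  ultimately show ?thesis
    by (simp add: ricci_def riemann_def christoffel_drive_metric[abs_def] sum.distrib sum_subtractf x_def)
qed

text \<open>Write \<open>r\<close> for the normal contraction of the Ricci tensor and
  \<open>K\<close> for its spatial trace. The split inverse metric gives scalar curvature
  \<open>K - r\<close>, and the normal has square \<open>- 1\<close>, so the left side is
  \<open>r + (K - r) / 2\<close>.\<close>

lemma einstein_normal_normal:
  fixes p :: event
  defines "n \<equiv> ($) (unit_normal \<beta> p)"
  shows "(\<Sum>a\<in>UNIV. \<Sum>b\<in>UNIV. einstein (drive_metric \<beta>) a b p * n a * n b) =
    ((\<Sum>a\<in>UNIV. \<Sum>b\<in>UNIV. ricci (drive_metric \<beta>) a b p * n a * n b)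
      + (\<Sum>k\<in>UNIV. ricci (drive_metric \<beta>) (Inr k) (Inr k) p)) / 2"
proof -
  let ?g = "drive_metric \<beta>" and ?R = "\<lambda>a b. ricci (drive_metric \<beta>) a b p"
    and ?b = "($) (\<beta> (spatial p))" and ?s = "scalar_curvature (drive_metric \<beta>) p"
  have n [simp]: "n (Inl u) = 1" "n (Inr k) = - ?b k" for u k
    by (simp_all add: n_def unit_normal_def event_def)
  have norm: "(\<Sum>a\<in>UNIV. \<Sum>b\<in>UNIV. ?g p $ a $ b * n a * n b) = - 1"
    by (simp add: sum_spacetime drive_metric_nth mult_delta_left sum_3 algebra_simps)
  have dx: "(\<Sum>a\<in>UNIV. \<Sum>b\<in>UNIV. (\<Sum>k\<in>UNIV. dx k a * dx k b) * ?R a b) = (\<Sum>k\<in>UNIV. ?R (Inr k) (Inr k))"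
    by (simp add: sum_spacetime dx_def mult_delta_left)
  have "?s = (\<Sum>k\<in>UNIV. ?R (Inr k) (Inr k)) - (\<Sum>a\<in>UNIV. \<Sum>b\<in>UNIV. ?R a b * n a * n b)"
    unfolding scalar_curvature_def matrix_inv_drive_metric vec_lambda_beta left_diff_distrib
      sum_subtractf dx
    by (simp add: mult_ac n_def)
  moreover have "(\<Sum>a\<in>UNIV. \<Sum>b\<in>UNIV. einstein ?g a b p * n a * n b) =
      (\<Sum>a\<in>UNIV. \<Sum>b\<in>UNIV. ?R a b * n a * n b) - ?s / 2 * (\<Sum>a\<in>UNIV. \<Sum>b\<in>UNIV. ?g p $ a $ b * n a * n b)"
    unfolding einstein_def left_diff_distrib sum_subtractf
    by (simp add: sum_distrib_left mult_ac)
  moreover have "E = (r + K) / 2" if "s = K - r" "E = r - s / 2 * - 1" for s K r E :: real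
    using that by (simp add: diff_divide_distrib add_divide_distrib)
  ultimately show ?thesis
    unfolding norm by blast
qed

section \<open>Contractions of the Ricci tensor\<close>

lemma partial_strain: "partial k (strain i j) x = (partial k (grad i j) x + partial k (grad j i) x) / 2"
  by (simp add: strain_def[abs_def])

lemma partial_vorticity: "partial k (vorticity i j) x = (partial k (grad i j) x - partial k (grad j i) x) / 2"
  by (simp add: vorticity_def[abs_def])

lemma partial_strain_shift:
  "partial k (strain_shift i) x =
    (\<Sum>j\<in>UNIV. partial k (strain i j) x * \<beta> x $ j + strain i j x * grad k j x)"
  by (simp add: strain_shift_def[abs_def])

lemma partial_grad_shift:
  "partial k (grad_shift i) x =
    (\<Sum>j\<in>UNIV. partial k (grad i j) x * \<beta> x $ j + grad i j x * grad k j x)"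
  by (simp add: grad_shift_def[abs_def])

lemma partial_strain_shift_shift:
  "partial k strain_shift_shift x =
    (\<Sum>i\<in>UNIV. partial k (strain_shift i) x * \<beta> x $ i + strain_shift i x * grad k i x)"
  by (simp add: strain_shift_shift_def[abs_def])

text \<open>Let \<open>S\<close> be the symmetric form with components
  \<open>strain_shift_shift\<close>, \<open>strain_shift\<close> and \<open>strain\<close>. It
  annihilates the normal \<open>n\<close>, so \<open>S(n,n) = 0\<close>, and differentiating this
  also gives \<open>(partial k S)(n,n) = 0\<close>. The left side is \<open>partial k\<close> of the
  shift component times \<open>S\<close>, contracted twice with \<open>n\<close>.\<close>

lemma partial_strain_normal_normal:
  "grad k k x * strain_shift_shift x + \<beta> x $ k * partial k strain_shift_shift x
    - 2 * (\<Sum>i\<in>UNIV. \<beta> x $ i * (grad k k x * strain_shift i x + \<beta> x $ k * partial k (strain_shift i) x))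
    + (\<Sum>i\<in>UNIV. \<Sum>j\<in>UNIV. \<beta> x $ i * \<beta> x $ j *
        (grad k k x * strain i j x + \<beta> x $ k * partial k (strain i j) x)) = 0"
proof -
  have "strain 2 1 x = strain 1 2 x" "strain 3 1 x = strain 1 3 x" "strain 3 2 x = strain 2 3 x"
    by (simp_all add: strain_commute)
  then show ?thesis
    by (simp add: partial_strain_shift_shift partial_strain_shift strain_shift_shift_def
        strain_shift_def sum_3 algebra_simps)
qed

lemma sum_partial_\<Gamma>_normal_normal:
  fixes p :: event
  defines "n \<equiv> ($) (unit_normal \<beta> p)" and "x \<equiv> spatial p"
  shows "(\<Sum>a\<in>UNIV. \<Sum>b\<in>UNIV. partial k (\<Gamma> (Inr k) b a) x * n a * n b) =
    - (\<Sum>i\<in>UNIV. (grad k i x)\<^sup>2) - (\<Sum>i\<in>UNIV. \<beta> x $ i * partial k (grad i k) x)"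
proof -
  have n [simp]: "n (Inl u) = 1" "n (Inr k) = - \<beta> x $ k" for u k
    by (simp_all add: n_def x_def unit_normal_def event_def)
  \<comment> \<open>The bracket collects every term carrying the factor \<open>\<beta> x $ k\<close>
    in \<open>\<Gamma> (Inr k)\<close>. Outside it remain \<open>grad_shift\<close> in the time-time
    component and the vorticity in the two mixed ones, hence the factor 2.\<close>
  have "(\<Sum>a\<in>UNIV. \<Sum>b\<in>UNIV. partial k (\<Gamma> (Inr k) b a) x * n a * n b) =
      (grad k k x * strain_shift_shift x + \<beta> x $ k * partial k strain_shift_shift x
      - 2 * (\<Sum>i\<in>UNIV. \<beta> x $ i * (grad k k x * strain_shift i x + \<beta> x $ k * partial k (strain_shift i) x))
      + (\<Sum>i\<in>UNIV. \<Sum>j\<in>UNIV. \<beta> x $ i * \<beta> x $ j *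
          (grad k k x * strain i j x + \<beta> x $ k * partial k (strain i j) x)))
      - partial k (grad_shift k) x - 2 * (\<Sum>i\<in>UNIV. \<beta> x $ i * partial k (vorticity i k) x)"
    by (simp add: sum_spacetime \<Gamma>_def sum_3 algebra_simps)
  also have "\<dots> = - partial k (grad_shift k) x - 2 * (\<Sum>i\<in>UNIV. \<beta> x $ i * partial k (vorticity i k) x)"
    unfolding partial_strain_normal_normal by simp
  \<comment> \<open>The terms in \<open>partial k (grad k i)\<close> cancel between
    \<open>grad_shift\<close> and the vorticity.\<close>
  also have "\<dots> = - (\<Sum>i\<in>UNIV. (grad k i x)\<^sup>2) - (\<Sum>i\<in>UNIV. \<beta> x $ i * partial k (grad i k) x)"
    by (simp add: partial_grad_shift partial_vorticity sum_3 power2_eq_square field_simps)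
  finally show ?thesis .
qed

lemma sum_\<Gamma>_\<Gamma>_normal_normal:
  fixes p :: event
  defines "n \<equiv> ($) (unit_normal \<beta> p)" and "x \<equiv> spatial p"
  shows "(\<Sum>a\<in>UNIV. \<Sum>b\<in>UNIV. (\<Sum>c\<in>UNIV. \<Sum>e\<in>UNIV. \<Gamma> c b e x * \<Gamma> e c a x) * n a * n b) =
    - (\<Sum>j\<in>UNIV. \<Sum>k\<in>UNIV. (vorticity j k x)\<^sup>2)"
proof -
  have n [simp]: "n (Inl u) = 1" "n (Inr k) = - \<beta> x $ k" for u k
    by (simp_all add: n_def x_def unit_normal_def event_def)
  \<comment> \<open>Contracting one lower index with the normal leaves only the vorticity in \<open>N\<close> and its \<open>Inr k\<close>,
    \<open>Inl 1\<close> entries, which do not contribute to the trace of \<open>N\<^sup>2\<close>.\<close>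
  define N where "N c e = (\<Sum>a\<in>UNIV. \<Gamma> c a e x * n a)" for c e
  have N_Inl: "N (Inl u) e = 0" for u e
    by (cases e) (simp_all add: N_def \<Gamma>_def sum_spacetime strain_shift_shift_def strain_shift_def
        strain_commute sum_negf mult.commute)
  have N_Inr: "N (Inr k) (Inr j) = vorticity j k x" for k j
    by (simp add: N_def \<Gamma>_def sum_spacetime strain_shift_def sum_distrib_left sum_negf mult_ac)
      (simp add: strain_commute)
  have "(\<Sum>a\<in>UNIV. \<Sum>b\<in>UNIV. (\<Sum>c\<in>UNIV. \<Sum>e\<in>UNIV. \<Gamma> c b e x * \<Gamma> e c a x) * n a * n b) =
      (\<Sum>a\<in>UNIV. \<Sum>b\<in>UNIV. \<Sum>c\<in>UNIV. \<Sum>e\<in>UNIV. (\<Gamma> c b e x * n b) * (\<Gamma> e a c x * n a))"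
    by (simp add: sum_distrib_left sum_distrib_right mult_ac \<Gamma>_commute)
  also have "\<dots> = (\<Sum>c\<in>UNIV. \<Sum>e\<in>UNIV. N c e * N e c)"
    unfolding N_def sum_product
    by (subst sum_swap_pairs, rule sum.cong[OF refl], rule sum.cong[OF refl], rule sum.swap)
  also have "\<dots> = (\<Sum>j\<in>UNIV. \<Sum>k\<in>UNIV. vorticity k j x * vorticity j k x)"
    by (simp add: sum_spacetime N_Inl N_Inr)
  \<comment> \<open>The sign comes from the antisymmetry of the vorticity.\<close>
  also have "\<dots> = - (\<Sum>j\<in>UNIV. \<Sum>k\<in>UNIV. (vorticity j k x)\<^sup>2)"
    by (simp add: vorticity_def sum_3 power2_eq_square field_simps)
  finally show ?thesis .
qed

text \<open>For fixed \<open>i\<close> the terms free of vorticity are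
  \<open>s * s - 2 * s * s + s * s\<close> with \<open>s = strain_shift i x\<close>. What is left
  pairs the symmetric strain with the antisymmetric vorticity and vanishes after summing over
  \<open>i\<close>.\<close>

lemma sum_\<Gamma>_\<Gamma>_spatial:
  "(\<Sum>i\<in>UNIV. \<Sum>c\<in>UNIV. \<Sum>e\<in>UNIV. \<Gamma> c (Inr i) e x * \<Gamma> e c (Inr i) x) = 0"
proof -
  have "(\<Sum>c\<in>UNIV. \<Sum>e\<in>UNIV. \<Gamma> c (Inr i) e x * \<Gamma> e c (Inr i) x) =
      - 2 * (\<Sum>k\<in>UNIV. strain i k x * vorticity i k x)" for i
  proof -
    have s: "strain_shift i x = (\<Sum>k\<in>UNIV. strain i k x * \<beta> x $ k)"
      by (simp add: strain_shift_def)
    show ?thesis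
      unfolding sum_spacetime \<Gamma>_def
      by (simp add: strain_commute[of _ i] s sum_3 algebra_simps)
  qed
  moreover have "(\<Sum>i\<in>UNIV. \<Sum>k\<in>UNIV. strain i k x * vorticity i k x) = 0"
    by (simp add: strain_def vorticity_def sum_3 field_simps)
  ultimately show ?thesis
    by (simp add: sum_negf flip: sum_distrib_left)
qed

text \<open>The trace of the strain is the divergence of the shift, so this is the product rule for
  the divergence of the shift times its own divergence.\<close>

lemma sum_partial_\<Gamma>_spatial:
  "(\<Sum>i\<in>UNIV. \<Sum>k\<in>UNIV. partial k (\<Gamma> (Inr k) (Inr i) (Inr i)) x) =
    (\<Sum>k\<in>UNIV. grad k k x)\<^sup>2 + (\<Sum>k\<in>UNIV. \<Sum>i\<in>UNIV. \<beta> x $ k * partial k (grad i i) x)"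
  by (simp add: \<Gamma>_def partial_strain strain_def sum_3 power2_eq_square algebra_simps)

text \<open>
  The last sum vanishes by the symmetry of mixed partial derivatives, which leaves the Hamiltonian
  constraint of a flat slice. It is kept because it is quadratic in the shift anyway.
\<close>

lemma eulerian_density_eq:
  fixes p :: event
  defines "x \<equiv> spatial p"
  shows "eulerian_density \<beta> p =
    ((\<Sum>k\<in>UNIV. grad k k x)\<^sup>2 - (\<Sum>i\<in>UNIV. \<Sum>j\<in>UNIV. (strain i j x)\<^sup>2)
      + (\<Sum>i\<in>UNIV. \<Sum>k\<in>UNIV. \<beta> x $ i * (partial i (grad k k) x - partial k (grad i k) x))) / (16 * pi)"
proof -
  define n where "n = ($) (unit_normal \<beta> p)"
  have swap: "(\<Sum>a\<in>UNIV. \<Sum>b\<in>UNIV. (\<Sum>k\<in>UNIV. partial k (\<Gamma> (Inr k) b a) x) * n a * n b) =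
      (\<Sum>k\<in>UNIV. \<Sum>a\<in>UNIV. \<Sum>b\<in>UNIV. partial k (\<Gamma> (Inr k) b a) x * n a * n b)"
    by (simp add: sum_distrib_right) (subst sum.swap, subst (2) sum.swap, rule refl)
  have "(\<Sum>a\<in>UNIV. \<Sum>b\<in>UNIV. ricci (drive_metric \<beta>) a b p * n a * n b) =
      (\<Sum>k\<in>UNIV. - (\<Sum>i\<in>UNIV. (grad k i x)\<^sup>2) - (\<Sum>i\<in>UNIV. \<beta> x $ i * partial k (grad i k) x))
      + (\<Sum>j\<in>UNIV. \<Sum>k\<in>UNIV. (vorticity j k x)\<^sup>2)"
    unfolding ricci_drive_metric left_diff_distrib sum_subtractf
    using swap sum_\<Gamma>_\<Gamma>_normal_normal[of p] sum_partial_\<Gamma>_normal_normal[of _ p]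
    by (simp add: n_def x_def sum_subtractf)
  moreover have "(\<Sum>k\<in>UNIV. ricci (drive_metric \<beta>) (Inr k) (Inr k) p) =
      (\<Sum>k\<in>UNIV. grad k k x)\<^sup>2 + (\<Sum>k\<in>UNIV. \<Sum>i\<in>UNIV. \<beta> x $ k * partial k (grad i i) x)"
    unfolding ricci_drive_metric sum_subtractf
    using sum_partial_\<Gamma>_spatial[of x] sum_\<Gamma>_\<Gamma>_spatial[of x] by (simp add: x_def)
  \<comment> \<open>Symmetric and antisymmetric parts of the gradient are orthogonal. This trades
    gradient and vorticity squares for the strain alone.\<close>
  moreover have "(\<Sum>j\<in>UNIV. \<Sum>k\<in>UNIV. (vorticity j k x)\<^sup>2) =
      (\<Sum>k\<in>UNIV. \<Sum>i\<in>UNIV. (grad k i x)\<^sup>2) - (\<Sum>i\<in>UNIV. \<Sum>j\<in>UNIV. (strain i j x)\<^sup>2)"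
    by (simp add: vorticity_def strain_def sum_3 power2_eq_square field_simps)
  moreover have "eulerian_density \<beta> p =
      (\<Sum>a\<in>UNIV. \<Sum>b\<in>UNIV. einstein (drive_metric \<beta>) a b p * n a * n b) / (8 * pi)"
    by (simp add: eulerian_density_def stress_energy_def n_def sum_divide_distrib)
  moreover have "(\<Sum>k\<in>UNIV. \<Sum>i\<in>UNIV. \<beta> x $ i * partial k (grad i k) x) =
      (\<Sum>i\<in>UNIV. \<Sum>k\<in>UNIV. \<beta> x $ i * partial k (grad i k) x)"
    by (rule sum.swap)
  ultimately show ?thesis
    using einstein_normal_normal[of p]
    by (simp add: n_def sum_subtractf sum_negf right_diff_distrib)
qed

end

section \<open>Regularity of smooth shifts\<close>

lemma partial_nth:
  assumes "f differentiable at x"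
  shows "partial i (\<lambda>y. f y $ j) x = frechet_derivative f (at x) (axis i 1) $ j"
  using assms by (intro partial_eqI bounded_linear.has_derivative[OF bounded_linear_vec_nth])
    (simp add: frechet_derivative_works)

context
  fixes F :: "real ^ 'm \<Rightarrow> real ^ 'n"
  assumes smooth: "smooth F"
begin

lemma smooth_differentiable: "F differentiable at x"
  using smooth unfolding smooth_def by (metis continuously_differentiable.simps(2))

lemma smooth_frechet_derivative: "smooth (\<lambda>x. frechet_derivative F (at x) v)"
  using smooth unfolding smooth_def by (metis continuously_differentiable.simps(2))

lemma smooth_continuous: "continuous_on UNIV F"
  using smooth unfolding smooth_def by (metis continuously_differentiable.simps(1))

text \<open>Identifies a partial derivative with a component of a directional derivative, which is
  again smooth; regularity of higher partial derivatives follows by iteration.\<close>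

lemma smooth_partial: "partial i (\<lambda>y. F y $ j) = (\<lambda>x. frechet_derivative F (at x) (axis i 1) $ j)"
  by (simp add: fun_eq_iff partial_nth smooth_differentiable)

end

lemma smooth_twice_differentiable_shift: "smooth F \<Longrightarrow> twice_differentiable_shift F"
  by standard (simp_all add: smooth_differentiable smooth_frechet_derivative smooth_partial)

section \<open>Quadratic scaling and integration\<close>

context twice_differentiable_shift
begin

lemma twice_differentiable_shift_scaleR: "twice_differentiable_shift (\<lambda>y. v *\<^sub>R \<beta> y)"
proof
  fix i j x
  have "partial i (\<lambda>y. (v *\<^sub>R \<beta> y) $ j) = (\<lambda>x. v * partial i (\<lambda>y. \<beta> y $ j) x)"
    by (simp add: fun_eq_iff)
  then show "partial i (\<lambda>y. (v *\<^sub>R \<beta> y) $ j) differentiable at x"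
    by (simp del: partial_shift)
qed simp

text \<open>Each summand of the closed form is a product of two factors linear in the shift.\<close>

lemma eulerian_density_scaleR:
  "eulerian_density (\<lambda>y. v *\<^sub>R \<beta> y) p = v\<^sup>2 * eulerian_density \<beta> p"
proof -
  interpret V: twice_differentiable_shift "\<lambda>y. v *\<^sub>R \<beta> y"
    by (rule twice_differentiable_shift_scaleR)
  have grad: "V.grad i j = (\<lambda>x. v * grad i j x)" for i j
    by (simp add: V.grad_def fun_eq_iff)
  have strain: "V.strain i j x = v * strain i j x" for i j x
    by (simp add: V.strain_def strain_def grad algebra_simps)
  show ?thesis
    unfolding V.eulerian_density_eq eulerian_density_eq
    by (simp add: grad strain sum_3 power2_eq_square field_simps)
qed

end

text \<open>The closed form is polynomial in the shift and its first and second partial derivatives,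
  all continuous. This supplies the measurability of the density.\<close>

lemma continuous_on_eulerian_density:
  assumes "smooth F"
  shows "continuous_on UNIV (\<lambda>x. eulerian_density F (event t x))"
proof -
  interpret twice_differentiable_shift F
    by (rule smooth_twice_differentiable_shift) fact
  have F: "continuous_on UNIV F"
    using assms by (rule smooth_continuous)
  have grad: "continuous_on UNIV (grad i j)" for i j
    by (simp add: differentiable_imp_continuous_on differentiable_on_def differentiable_at_withinI)
  have "continuous_on UNIV (partial k (grad i j))" for i j k
    using assms by (simp add: grad_def smooth_partial smooth_frechet_derivative smooth_continuous
        continuous_on_component)
  with F grad show ?thesis
    unfolding eulerian_density_eq strain_def spatial_event
    by (intro continuous_intros) auto
qed

theorem lemma4:
  fixes F :: "real ^ 3 \<Rightarrow> real ^ 3" and D :: "(real ^ 3) set" and t v :: real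
  assumes "smooth F"
    and "D \<in> sets lebesgue"
    and "v > 0"
  shows "negative_energy F D t v = ennreal (v\<^sup>2) * negative_energy F D t 1"
proof -
  interpret twice_differentiable_shift F
    by (rule smooth_twice_differentiable_shift) fact
  define \<rho> where "\<rho> x = eulerian_density F (event t x)" for x
  have \<rho> [measurable]: "\<rho> \<in> borel_measurable lebesgue"
    unfolding \<rho>_def[abs_def]
    by (intro measurable_completion)
      (simp add: borel_measurable_continuous_onI continuous_on_eulerian_density assms(1))
  note assms(2) [measurable]
  have D [measurable]: "{x \<in> D. \<rho> x < 0} \<in> sets lebesgue"
  proof -
    have "{x \<in> D. \<rho> x < 0} = D \<inter> {x \<in> space lebesgue. \<rho> x < 0}" by auto
    also have "\<dots> \<in> sets lebesgue" by measurable
    finally show ?thesis .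
  qed
  \<comment> \<open>As \<open>v\<^sup>2\<close> is positive, the scaled density is negative exactly
    where \<open>\<rho>\<close> is, so the region of integration stays the same.\<close>
  have "negative_energy F D t v = (\<integral>\<^sup>+x\<in>{x \<in> D. \<rho> x < 0}. ennreal \<bar>v\<^sup>2 * \<rho> x\<bar> \<partial>lebesgue)"
    using assms(3) by (simp add: negative_energy_def eulerian_density_scaleR \<rho>_def Let_def mult_less_0_iff)
  also have "\<dots> = (\<integral>\<^sup>+x. ennreal (v\<^sup>2) * (ennreal \<bar>\<rho> x\<bar> * indicator {x \<in> D. \<rho> x < 0} x) \<partial>lebesgue)"
    by (simp add: abs_mult ennreal_mult mult.assoc)
  also have "\<dots> = ennreal (v\<^sup>2) * (\<integral>\<^sup>+x\<in>{x \<in> D. \<rho> x < 0}. ennreal \<bar>\<rho> x\<bar> \<partial>lebesgue)"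
    \<comment> \<open>Valid in \<open>[0,\<infinity>]\<close>, also for an infinite integral;
      measurability of the integrand rests on \<open>\<rho>\<close> and \<open>D\<close>.\<close>
    by (rule nn_integral_cmult) measurable
  also have "\<dots> = ennreal (v\<^sup>2) * negative_energy F D t 1"
    by (simp add: negative_energy_def \<rho>_def Let_def)
  finally show ?thesis .
qed

end
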